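(* Let $\phi$ and $\phi'$ be monotone formulas. Then $\phi\rightarrow\phi'$ is locally transferrable.
   Context: Formulas are built from variables and constants $\mathbf{0},\mathbf{1}$ using ${\sim},\wedge,\vee,\rightarrow,\Box,\lozenge$. A formula is monotone iff it contains none of $\rightarrow$, ${\sim}$ (so it is built from variables, $\mathbf{0},\mathbf{1}$ by $\wedge,\vee,\Box,\lozenge$). On a crisp frame $\langle W,R\rangle$ ($W\ne\varnothing$, $R\subseteq W\times W$), a $\mathbf{K}\mathsf{biG}$ valuation $v:\mathtt{Prop}\times W\to[0,1]$ is extended by: $\mathbf{0}\mapsto0$, $\mathbf{1}\mapsto1$, $\wedge,\vee$ as $\min,\max$, $a\rightarrow b=1$ if $a\le b$ else $b$, ${\sim}a=1$ iff $a=0$ (else $0$), $v(\Box\phi,w)=\inf\{v(\phi,w'):wRw'\}$, $v(\lozenge\phi,w)=\sup\{v(\phi,w'):wRw'\}$ ($\inf\varnothing=1,\sup\varnothing=0$). $\mathfrak{F},w\models_{\mathbf{K}\mathsf{biG}}\phi$ means $v(\phi,w)=1$ for every such valuation on $\mathfrak{F}$; $\mathfrak{F},w\models_{\mathbf{K}}\phi$ means $\phi$ is true at $w$ under every classical valuation on $\mathfrak{F}$ in classical modal logic $\mathbf{K}$. A formula $\phi$ is locally transferrable iff for every crisp frame $\mathfrak{F}$ and every $w$ in it, $\mathfrak{F},w\models_{\mathbf{K}}\phi$ iff $\mathfrak{F},w\models_{\mathbf{K}\mathsf{biG}}\phi$. *)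

theory Defs
  imports Complex_Main
begin

datatype 'p fm =
    Var 'p
  | Zero
  | One
  | Neg "'p fm"
  | And "'p fm" "'p fm"
  | Or "'p fm" "'p fm"
  | Imp "'p fm" "'p fm"
  | Box "'p fm"
  | Dia "'p fm"

primrec monotone_fm :: "'p fm \<Rightarrow> bool" where
  "monotone_fm (Var p) \<longleftrightarrow> True"
| "monotone_fm Zero \<longleftrightarrow> True"
| "monotone_fm One \<longleftrightarrow> True"
| "monotone_fm (Neg \<phi>) \<longleftrightarrow> False"
| "monotone_fm (And \<phi> \<psi>) \<longleftrightarrow> monotone_fm \<phi> \<and> monotone_fm \<psi>"
| "monotone_fm (Or \<phi> \<psi>) \<longleftrightarrow> monotone_fm \<phi> \<and> monotone_fm \<psi>"
| "monotone_fm (Imp \<phi> \<psi>) \<longleftrightarrow> False"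
| "monotone_fm (Box \<phi>) \<longleftrightarrow> monotone_fm \<phi>"
| "monotone_fm (Dia \<phi>) \<longleftrightarrow> monotone_fm \<phi>"

definition crisp_frame :: "'w set \<Rightarrow> ('w \<times> 'w) set \<Rightarrow> bool" where
  "crisp_frame W R \<longleftrightarrow> W \<noteq> {} \<and> R \<subseteq> W \<times> W"

text \<open>Infimum and supremum are taken in the unit interval, so the empty ones are 1 and 0;
  on the type of reals these two cases have to be separated from \<^const>\<open>Inf\<close> and \<^const>\<open>Sup\<close>.\<close>

primrec kbig_val :: "('w \<times> 'w) set \<Rightarrow> ('p \<Rightarrow> 'w \<Rightarrow> real) \<Rightarrow> 'p fm \<Rightarrow> 'w \<Rightarrow> real" where
  "kbig_val R v (Var p) w = v p w"
| "kbig_val R v Zero w = 0"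
| "kbig_val R v One w = 1"
| "kbig_val R v (Neg \<phi>) w = (if kbig_val R v \<phi> w = 0 then 1 else 0)"
| "kbig_val R v (And \<phi> \<psi>) w = min (kbig_val R v \<phi> w) (kbig_val R v \<psi> w)"
| "kbig_val R v (Or \<phi> \<psi>) w = max (kbig_val R v \<phi> w) (kbig_val R v \<psi> w)"
| "kbig_val R v (Imp \<phi> \<psi>) w =
     (if kbig_val R v \<phi> w \<le> kbig_val R v \<psi> w then 1 else kbig_val R v \<psi> w)"
| "kbig_val R v (Box \<phi>) w =
     (if R `` {w} = {} then 1 else (INF w'\<in>R `` {w}. kbig_val R v \<phi> w'))"
| "kbig_val R v (Dia \<phi>) w =
     (if R `` {w} = {} then 0 else (SUP w'\<in>R `` {w}. kbig_val R v \<phi> w'))"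

definition kbig_valid_at :: "'w set \<Rightarrow> ('w \<times> 'w) set \<Rightarrow> 'w \<Rightarrow> 'p fm \<Rightarrow> bool" where
  "kbig_valid_at W R w \<phi> \<longleftrightarrow>
     (\<forall>v. (\<forall>p. \<forall>u\<in>W. v p u \<in> {0..1}) \<longrightarrow> kbig_val R v \<phi> w = 1)"

primrec k_sat :: "('w \<times> 'w) set \<Rightarrow> ('p \<Rightarrow> 'w \<Rightarrow> bool) \<Rightarrow> 'p fm \<Rightarrow> 'w \<Rightarrow> bool" where
  "k_sat R V (Var p) w \<longleftrightarrow> V p w"
| "k_sat R V Zero w \<longleftrightarrow> False"
| "k_sat R V One w \<longleftrightarrow> True"
| "k_sat R V (Neg \<phi>) w \<longleftrightarrow> \<not> k_sat R V \<phi> w"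
| "k_sat R V (And \<phi> \<psi>) w \<longleftrightarrow> k_sat R V \<phi> w \<and> k_sat R V \<psi> w"
| "k_sat R V (Or \<phi> \<psi>) w \<longleftrightarrow> k_sat R V \<phi> w \<or> k_sat R V \<psi> w"
| "k_sat R V (Imp \<phi> \<psi>) w \<longleftrightarrow> (k_sat R V \<phi> w \<longrightarrow> k_sat R V \<psi> w)"
| "k_sat R V (Box \<phi>) w \<longleftrightarrow> (\<forall>w'. (w, w') \<in> R \<longrightarrow> k_sat R V \<phi> w')"
| "k_sat R V (Dia \<phi>) w \<longleftrightarrow> (\<exists>w'. (w, w') \<in> R \<and> k_sat R V \<phi> w')"

text \<open>Classical valuations are total on the type of worlds; for a frame \<open>(W, R)\<close> and \<open>w \<in> W\<close>
  their values outside \<open>W\<close> do not influence \<^const>\<open>k_sat\<close> at \<open>w\<close>, so \<open>W\<close> is not an argument.\<close>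

definition k_valid_at :: "('w \<times> 'w) set \<Rightarrow> 'w \<Rightarrow> 'p fm \<Rightarrow> bool" where
  "k_valid_at R w \<phi> \<longleftrightarrow> (\<forall>V. k_sat R V \<phi> w)"

text \<open>A HOL formula cannot quantify over types, so the type from which the worlds of the frames
  are drawn is a parameter; a statement with this parameter a type variable covers all frames.\<close>

definition locally_transferrable :: "'w itself \<Rightarrow> 'p fm \<Rightarrow> bool" where
  "locally_transferrable (_ :: 'w itself) \<phi> \<longleftrightarrow>
     (\<forall>(W :: 'w set) R. crisp_frame W R \<longrightarrow>
        (\<forall>w\<in>W. k_valid_at R w \<phi> \<longleftrightarrow> kbig_valid_at W R w \<phi>))"

end

theory Submission
  imports Defs
begin

text \<open>Cutting a many-valued valuation at a level \<open>c \<in> (0, 1)\<close> gives a classical one. On monotone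
  formulas the cut is respected only up to strictness, since infima and suprema need not be
  attained: values above \<open>c\<close> become true, and truth forces a value of at least \<open>c\<close>. If
  the value of \<open>\<phi>\<close> exceeded that of \<open>\<phi>'\<close>, a level strictly between the two would therefore refute
  \<open>\<phi> \<rightarrow> \<phi>'\<close> classically. Conversely, classical valuations are the \<open>{0, 1}\<close>-valued ones.\<close>

text \<open>On reals, \<open>INF\<close> and \<open>SUP\<close> behave as greatest lower and least
  upper bounds only over nonempty bounded sets; this lemma supplies the bounds. As \<open>R\<close>
  stays inside \<open>W\<close>, every world reached from \<open>u\<close> is one where
  \<open>v\<close> is constrained.\<close>

lemma kbig_val_unit_interval:
  assumes "R \<subseteq> W \<times> W" and "\<forall>p. \<forall>u\<in>W. v p u \<in> {0..1}" and "u \<in> W"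
  shows "kbig_val R v \<psi> u \<in> {0..1}"
  using assms(3)
proof (induction \<psi> arbitrary: u)
  case (Box \<psi>)
  have *: "kbig_val R v \<psi> u' \<in> {0..1}" if "u' \<in> R `` {u}" for u'
    using Box that assms(1) by blast
  show ?case
  proof (cases "R `` {u} = {}")
    case False
    \<comment> \<open>Any one successor will do: its value lies above the infimum and is at most
      1.\<close>
    then obtain u' where u': "u' \<in> R `` {u}" by blast
    have "(INF u'\<in>R `` {u}. kbig_val R v \<psi> u') \<ge> 0"
      using False * by (intro cINF_greatest) auto
    moreover have "(INF u'\<in>R `` {u}. kbig_val R v \<psi> u') \<le> kbig_val R v \<psi> u'"
      using * u' by (intro cINF_lower bdd_belowI2[where m = 0]) auto
    ultimately show ?thesis using False *[OF u'] by simp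
  qed simp
next
  case (Dia \<psi>)
  have *: "kbig_val R v \<psi> u' \<in> {0..1}" if "u' \<in> R `` {u}" for u'
    using Dia that assms(1) by blast
  show ?case
  proof (cases "R `` {u} = {}")
    case False
    then obtain u' where u': "u' \<in> R `` {u}" by blast
    have "(SUP u'\<in>R `` {u}. kbig_val R v \<psi> u') \<le> 1"
      using False * by (intro cSUP_least) auto
    moreover have "kbig_val R v \<psi> u' \<le> (SUP u'\<in>R `` {u}. kbig_val R v \<psi> u')"
      using * u' by (intro cSUP_upper bdd_aboveI2[where M = 1]) auto
    ultimately show ?thesis using False *[OF u'] by simp
  qed simp
qed (use assms(2) in \<open>simp_all add: le_max_iff_disj min_le_iff_disj\<close>)

lemma monotone_fm_cut:
  assumes "R \<subseteq> W \<times> W" and "\<forall>p. \<forall>u\<in>W. v p u \<in> {0..1}"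
    and "0 < c" and "c < 1" and "monotone_fm \<psi>" and "u \<in> W"
  shows "(c < kbig_val R v \<psi> u \<longrightarrow> k_sat R (\<lambda>p u. c \<le> v p u) \<psi> u) \<and>
    (k_sat R (\<lambda>p u. c \<le> v p u) \<psi> u \<longrightarrow> c \<le> kbig_val R v \<psi> u)"
  using assms(5,6)
proof (induction \<psi> arbitrary: u)
  case (Box \<psi>)
  have *: "kbig_val R v \<psi> u' \<in> {0..1}" if "u' \<in> R `` {u}" for u'
    using kbig_val_unit_interval[OF assms(1,2)] that assms(1) by blast
  have lower: "(INF u'\<in>R `` {u}. kbig_val R v \<psi> u') \<le> kbig_val R v \<psi> u'" if "u' \<in> R `` {u}" for u'
    using * that by (intro cINF_lower bdd_belowI2[where m = 0]) auto
  have IH: "c < kbig_val R v \<psi> u' \<Longrightarrow> k_sat R (\<lambda>p u. c \<le> v p u) \<psi> u'"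
    "k_sat R (\<lambda>p u. c \<le> v p u) \<psi> u' \<Longrightarrow> c \<le> kbig_val R v \<psi> u'" if "u' \<in> R `` {u}" for u'
    using Box that assms(1) by auto
  show ?case
  proof (cases "R `` {u} = {}")
    case True
    \<comment> \<open>The default value 1 exceeds \<open>c\<close>, in agreement with the vacuous
      truth of the box.\<close>
    then show ?thesis using assms(4) by auto
  next
    case False
    \<comment> \<open>Only the weak inequality passes to the infimum: values all above
      \<open>c\<close> may still have infimum \<open>c\<close>.\<close>
    have "c \<le> (INF u'\<in>R `` {u}. kbig_val R v \<psi> u')" if "k_sat R (\<lambda>p u. c \<le> v p u) (Box \<psi>) u"
      using False that IH by (intro cINF_greatest) auto
    moreover have "k_sat R (\<lambda>p u. c \<le> v p u) (Box \<psi>) u"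
      if "c < (INF u'\<in>R `` {u}. kbig_val R v \<psi> u')"
      using IH(1) less_le_trans[OF that lower] by simp
    ultimately show ?thesis using False by simp
  qed
next
  case (Dia \<psi>)
  have *: "kbig_val R v \<psi> u' \<in> {0..1}" if "u' \<in> R `` {u}" for u'
    using kbig_val_unit_interval[OF assms(1,2)] that assms(1) by blast
  have bdd: "bdd_above (kbig_val R v \<psi> ` (R `` {u}))"
    using * by (intro bdd_aboveI2[where M = 1]) auto
  have IH: "c < kbig_val R v \<psi> u' \<Longrightarrow> k_sat R (\<lambda>p u. c \<le> v p u) \<psi> u'"
    "k_sat R (\<lambda>p u. c \<le> v p u) \<psi> u' \<Longrightarrow> c \<le> kbig_val R v \<psi> u'" if "u' \<in> R `` {u}" for u'
    using Dia that assms(1) by auto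
  show ?case
  proof (cases "R `` {u} = {}")
    case True
    \<comment> \<open>The default value 0 lies below \<open>c\<close>, in agreement with the falsity
      of the diamond.\<close>
    then show ?thesis using assms(3) by auto
  next
    case False
    have "c \<le> (SUP u'\<in>R `` {u}. kbig_val R v \<psi> u')" if "k_sat R (\<lambda>p u. c \<le> v p u) (Dia \<psi>) u"
      using that IH(2) cSUP_upper2[OF bdd] by auto
    \<comment> \<open>Strictness is essential here: a supremum above \<open>c\<close> yields a
      successor with value above \<open>c\<close>, whereas a supremum equal to \<open>c\<close> may
      be approached only from below.\<close>
    moreover have "k_sat R (\<lambda>p u. c \<le> v p u) (Dia \<psi>) u"
      if "c < (SUP u'\<in>R `` {u}. kbig_val R v \<psi> u')"
      using that IH(1) less_cSUP_iff[OF False bdd] by auto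
    ultimately show ?thesis using False by simp
  qed
qed (use assms(3,4) in \<open>auto simp: less_max_iff_disj le_max_iff_disj\<close>)

text \<open>The set {0, 1} is closed under all connectives, which act on it classically. Infima and
  suprema of nonempty subsets of {0, 1} are attained, so they act as quantifiers over the
  successors, and the defaults 1 and 0 match the empty quantifiers.\<close>

lemma kbig_val_of_bool:
  "kbig_val R (\<lambda>p u. of_bool (V p u)) \<psi> u = of_bool (k_sat R V \<psi> u)"
proof (induction \<psi> arbitrary: u)
  case (Box \<psi>)
  show ?case
  proof (cases "\<forall>u'. (u, u') \<in> R \<longrightarrow> k_sat R V \<psi> u'")
    case True
    then have "(INF u'\<in>R `` {u}. of_bool (k_sat R V \<psi> u')) = (1 :: real)" if "R `` {u} \<noteq> {}"
      using that by (intro cInf_eq_minimum) auto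
    with True Box show ?thesis by simp
  next
    case False
    then obtain u' where "u' \<in> R `` {u}" "\<not> k_sat R V \<psi> u'" by blast
    then have "(INF u'\<in>R `` {u}. of_bool (k_sat R V \<psi> u')) = (0 :: real)"
      \<comment> \<open>The refuting successor attains the minimum 0.\<close>
      by (intro cInf_eq_minimum) (auto intro: image_eqI[of _ _ u'])
    with False Box show ?thesis by auto
  qed
next
  case (Dia \<psi>)
  show ?case
  proof (cases "\<exists>u'. (u, u') \<in> R \<and> k_sat R V \<psi> u'")
    case True
    then obtain u' where "u' \<in> R `` {u}" "k_sat R V \<psi> u'" by blast
    then have "(SUP u'\<in>R `` {u}. of_bool (k_sat R V \<psi> u')) = (1 :: real)"
      by (intro cSup_eq_maximum) (auto intro: image_eqI[of _ _ u'])
    with True Dia show ?thesis by auto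
  next
    case False
    then have "(SUP u'\<in>R `` {u}. of_bool (k_sat R V \<psi> u')) = (0 :: real)" if "R `` {u} \<noteq> {}"
      using that by (intro cSup_eq_maximum) auto
    with False Dia show ?thesis by simp
  qed
qed auto

theorem theorem5:
  fixes \<phi> \<phi>' :: "'p fm"
  assumes "monotone_fm \<phi>" and "monotone_fm \<phi>'"
  shows "locally_transferrable TYPE('w) (Imp \<phi> \<phi>')"
  unfolding locally_transferrable_def
proof (intro allI impI ballI iffI)
  fix W :: "'w set" and R w
  assume "crisp_frame W R" and w: "w \<in> W" and valid: "k_valid_at R w (Imp \<phi> \<phi>')"
  then have R: "R \<subseteq> W \<times> W" by (simp add: crisp_frame_def)
  show "kbig_valid_at W R w (Imp \<phi> \<phi>')"
    unfolding kbig_valid_at_def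
  proof (intro allI impI)
    fix v :: "'p \<Rightarrow> 'w \<Rightarrow> real"
    assume v: "\<forall>p. \<forall>u\<in>W. v p u \<in> {0..1}"
    have "kbig_val R v \<phi> w \<le> kbig_val R v \<phi>' w"
    proof (rule ccontr)
      assume "\<not> kbig_val R v \<phi> w \<le> kbig_val R v \<phi>' w"
      then obtain c where c: "kbig_val R v \<phi>' w < c" "c < kbig_val R v \<phi> w"
        using dense unfolding not_le by blast
      \<comment> \<open>The level lies strictly between two values in [0, 1], so it is admissible
        for the cut.\<close>
      have "0 < c" "c < 1"
        using c kbig_val_unit_interval[OF R v w, of \<phi>] kbig_val_unit_interval[OF R v w, of \<phi>']
        by simp_all
      note cut = monotone_fm_cut[OF R v this _ w]
      have "k_sat R (\<lambda>p u. c \<le> v p u) \<phi> w"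
        using cut[OF assms(1)] c(2) by blast
      then have "k_sat R (\<lambda>p u. c \<le> v p u) \<phi>' w"
        using valid by (simp add: k_valid_at_def)
      then show False
        using cut[OF assms(2)] c(1) by auto
    qed
    then show "kbig_val R v (Imp \<phi> \<phi>') w = 1" by simp
  qed
next
  fix W :: "'w set" and R w
  assume valid: "kbig_valid_at W R w (Imp \<phi> \<phi>')"
  show "k_valid_at R w (Imp \<phi> \<phi>')"
    unfolding k_valid_at_def
  proof
    fix V :: "'p \<Rightarrow> 'w \<Rightarrow> bool"
    \<comment> \<open>Read with values 0 and 1, \<open>V\<close> is one of the valuations over which
      \<open>valid\<close> quantifies.\<close>
    have "kbig_val R (\<lambda>p u. of_bool (V p u)) (Imp \<phi> \<phi>') w = 1"
      using valid unfolding kbig_valid_at_def by (elim allE impE) auto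
    then show "k_sat R V (Imp \<phi> \<phi>') w"
      unfolding kbig_val_of_bool by simp
  qed
qed

end
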